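(* Let $p=p(n)\in[0,1]$ satisfy $p\ll 1/n$, i.e. $np\to 0$ as $n\to\infty$. Then with high probability $G_{n,p}$ has the EG Property.
   Context: $G_{n,p}$ is the Erdős–Rényi random graph on $n$ labelled vertices in which each of the $\binom n2$ possible edges is present independently with probability $p$. "With high probability" means with probability tending to $1$ as $n\to\infty$. For a graph $G$, $\nu(G)$ denotes the matching number (the size of a largest matching). The size of a graph is its number of edges. Subgraphs of $G$ are taken to have vertex set $V(G)$ and are identified with their edge sets; a "largest subgraph of $G$ with matching number $k$" is a subgraph $H\subseteq G$ with $\nu(H)=k$ having the maximum number of edges among all such subgraphs. A graph $G$ has the EG Property if for each integer $0\le k\le \nu(G)$, every largest subgraph $H$ of $G$ with matching number $k$ has one of the following two forms: (1) there is a set $W\subseteq V(G)$ with $|W|=2k+1$ such that $H$ consists of all edges of $G$ contained in $W$; (2) there is a set $S\subseteq V(G)$ with $|S|=k$ such that $H$ consists of all edges of $G$ meeting $S$ (i.e. having at least one endpoint in $S$). *)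

theory Defs
  imports "HOL-Probability.Probability" "HOL-Probability.Product_PMF" "HOL-Library.Ramsey"
begin

text \<open>
  A simple graph on a finite vertex set \<open>V\<close> is given by its edge set \<open>E \<subseteq> nsets V 2\<close>, a set of
  two-element subsets of \<open>V\<close>. A subgraph keeps the vertex set \<open>V\<close> and is a subset of \<open>E\<close>; its
  size is the cardinality of that subset. The definitions below are meant for finite \<open>V\<close> only.
\<close>

definition matching_in :: "'a set set \<Rightarrow> 'a set set \<Rightarrow> bool" where
  "matching_in E M \<longleftrightarrow> M \<subseteq> E \<and> pairwise disjnt M"

definition matching_number :: "'a set set \<Rightarrow> nat" where
  "matching_number E = Max (card ` {M. matching_in E M})"

definition largest_subgraph_with_matching_number :: "'a set set \<Rightarrow> nat \<Rightarrow> 'a set set \<Rightarrow> bool" where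
  "largest_subgraph_with_matching_number E k H \<longleftrightarrow>
     H \<subseteq> E \<and> matching_number H = k \<and>
     (\<forall>H'. H' \<subseteq> E \<and> matching_number H' = k \<longrightarrow> card H' \<le> card H)"

definition EG_property :: "'a set \<Rightarrow> 'a set set \<Rightarrow> bool" where
  "EG_property V E \<longleftrightarrow>
     (\<forall>k \<le> matching_number E. \<forall>H. largest_subgraph_with_matching_number E k H \<longrightarrow>
        (\<exists>W. W \<subseteq> V \<and> card W = 2 * k + 1 \<and> H = {e \<in> E. e \<subseteq> W}) \<or>
        (\<exists>S. S \<subseteq> V \<and> card S = k \<and> H = {e \<in> E. e \<inter> S \<noteq> {}}))"

text \<open>
  The random graph on the vertex set \<open>{..<n}\<close>: the indicators of the potential edges are
  independent Bernoulli variables. Note that \<open>bernoulli_pmf\<close> clamps its parameter to the unit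
  interval, so \<open>p \<in> {0..1}\<close> has to be assumed where it matters.
\<close>

definition erdos_renyi :: "nat \<Rightarrow> real \<Rightarrow> nat set set pmf" where
  "erdos_renyi n p =
     map_pmf (\<lambda>f. {e \<in> nsets {..<n} 2. f e})
       (Pi_pmf (nsets {..<n} 2) False (\<lambda>_. bernoulli_pmf p))"

definition with_high_probability :: "(nat \<Rightarrow> 'a pmf) \<Rightarrow> (nat \<Rightarrow> 'a \<Rightarrow> bool) \<Rightarrow> bool" where
  "with_high_probability X P \<longleftrightarrow>
     (\<lambda>n. measure_pmf.prob (X n) {x. P n x}) \<longlonglongrightarrow> 1"

end

theory Submission
  imports Defs
begin

text \<open>
  With high probability \<open>G\<^sub>n\<^sub>,\<^sub>p\<close> is a forest, and every forest has the EG Property. Indeed, a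
  subgraph \<open>H\<close> of a forest with matching number \<open>k\<close> has by Koenig's theorem a vertex cover \<open>S\<close> with
  \<open>k\<close> elements; the set of all edges meeting \<open>S\<close> contains \<open>H\<close> and still has matching number \<open>k\<close>, so
  a largest \<open>H\<close> equals it. Forests enter as the edge sets all of whose nonempty subsets \<open>F\<close> cover
  more than \<open>card F\<close> vertices. A graph that is not a forest contains \<open>k\<close> edges within some
  \<open>k\<close>-element vertex set, for some \<open>k \<ge> 1\<close>, and the expected number of such configurations is at
  most \<open>(e\<^sup>2 n p)\<^sup>k\<close>.
\<close>

section \<open>Leaves and Koenig's theorem for forests\<close>

text \<open>Double counting of incidences: without a leaf every covered vertex has degree at least
  2, so twice the number of covered vertices is at most the degree sum \<open>2 * card F\<close>,
  against the hypothesis.\<close>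

lemma exists_leaf:
  assumes "finite F" "\<And>e. e \<in> F \<Longrightarrow> card e = 2" "card F < card (\<Union>F)"
  obtains e v where "e \<in> F" "v \<in> e" "\<And>f. f \<in> F \<Longrightarrow> v \<in> f \<Longrightarrow> f = e"
proof (rule ccontr)
  note leafI = that
  assume "\<not> thesis"
  then have no_leaf: "\<exists>f\<in>F. v \<in> f \<and> f \<noteq> e" if "e \<in> F" "v \<in> e" for e v
    using leafI that by blast
  have fin: "finite e" if "e \<in> F" for e
    using assms(2)[OF that] by (metis card.infinite zero_neq_numeral)
  have fU: "finite (\<Union>F)" using assms(1) fin by blast
  have two: "2 \<le> card {f \<in> F. v \<in> f}" if "v \<in> \<Union>F" for v
  proof -
    obtain e where e: "e \<in> F" "v \<in> e" using \<open>v \<in> \<Union>F\<close> by blast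
    obtain f where f: "f \<in> F" "v \<in> f" "f \<noteq> e" using no_leaf[OF e] by blast
    have "card {e, f} \<le> card {f \<in> F. v \<in> f}"
      using e f assms(1) by (intro card_mono) auto
    then show ?thesis using f by simp
  qed
  have "2 * card (\<Union>F) = (\<Sum>v\<in>\<Union>F. 2)" by simp
  also have "\<dots> \<le> (\<Sum>v\<in>\<Union>F. card {f \<in> F. v \<in> f})" using two by (rule sum_mono)
  also have "\<dots> = (\<Sum>f\<in>F. card {v \<in> \<Union>F. v \<in> f})"
    using fU assms(1) by (rule sum_multicount_gen) simp
  also have "\<dots> = (\<Sum>f\<in>F. 2)"
  proof (rule sum.cong)
    fix f assume "f \<in> F"
    moreover from this have "{v \<in> \<Union>F. v \<in> f} = f" by blast
    ultimately show "card {v \<in> \<Union>F. v \<in> f} = 2" using assms(2) by simp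
  qed simp
  also have "\<dots> = 2 * card F" by simp
  finally show False using assms(3) by simp
qed

text \<open>Induction by stripping a leaf \<open>v\<close> with edge \<open>e = {u, v}\<close>: the
  other end \<open>u\<close> joins the cover and \<open>e\<close> joins the matching, so both grow
  by one. The forest condition passes to subsets of \<open>E\<close>.\<close>

lemma forest_koenig:
  assumes "finite E" "\<And>e. e \<in> E \<Longrightarrow> card e = 2"
    and "\<And>F. F \<subseteq> E \<Longrightarrow> F \<noteq> {} \<Longrightarrow> card F < card (\<Union>F)"
  shows "\<exists>S M. S \<subseteq> \<Union>E \<and> (\<forall>e\<in>E. e \<inter> S \<noteq> {}) \<and> matching_in E M \<and> card M = card S"
  using assms
proof (induction E rule: finite_psubset_induct)
  case (psubset E)
  show ?case
  proof (cases "E = {}")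
    case True
    then show ?thesis by (intro exI[of _ "{}"]) (simp add: matching_in_def)
  next
    case False
    obtain e v where e: "e \<in> E" "v \<in> e" and leaf: "\<And>f. f \<in> E \<Longrightarrow> v \<in> f \<Longrightarrow> f = e"
      using exists_leaf[OF psubset.hyps(1) psubset.prems(1) psubset.prems(2)[OF order_refl False]]
      by blast
    obtain u where u: "e = {u, v}"
      using psubset.prems(1)[OF e(1)] e(2) by (auto simp: card_2_iff)
    \<comment> \<open>All edges at \<open>u\<close> are dropped, since \<open>u\<close> covers them.
      The remaining edges also avoid \<open>v\<close>, which lies only on \<open>e\<close>, so
      \<open>e\<close> is disjoint from every matching of \<open>E'\<close>.\<close>
    define E' where "E' = {f \<in> E. u \<notin> f}"
    have "e \<notin> E'" using u by (simp add: E'_def)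
    then have "E' \<subset> E" using e(1) by (auto simp: E'_def)
    then have "\<exists>S M. S \<subseteq> \<Union>E' \<and> (\<forall>e\<in>E'. e \<inter> S \<noteq> {}) \<and> matching_in E' M \<and> card M = card S"
      using psubset.prems by (intro psubset.IH) auto
    then obtain S M where S: "S \<subseteq> \<Union>E'" "\<forall>e\<in>E'. e \<inter> S \<noteq> {}"
      and M: "matching_in E' M" "card M = card S" by blast
    have finE: "finite f" if "f \<in> E" for f
      using psubset.prems(1)[OF that] by (metis card.infinite zero_neq_numeral)
    have "finite S" 
      using psubset.hyps finE by (intro finite_subset[OF S(1)]) (auto simp: E'_def)
    have "finite M" 
      using M(1) psubset.hyps by (auto simp: matching_in_def E'_def intro: finite_subset)
    \<comment> \<open>This is where the cover has to lie within the covered vertices: no edge of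
      \<open>E'\<close> contains \<open>u\<close>, so inserting \<open>u\<close> really enlarges
      \<open>S\<close>.\<close>
    have "u \<notin> S" using S(1) by (auto simp: E'_def)
    have disj: "disjnt e f" if "f \<in> M" for f
    proof -
      have "f \<in> E" "u \<notin> f" using that M(1) by (auto simp: matching_in_def E'_def)
      moreover have "v \<notin> f" using leaf[of f] calculation u by blast
      ultimately show ?thesis by (simp add: u disjnt_def)
    qed
    have "e \<notin> M" using disj e(2) by (auto simp: disjnt_def)
    have "matching_in E (insert e M)"
      using M(1) e(1) disj by (auto simp: matching_in_def E'_def pairwise_insert disjnt_sym)
    moreover have "insert u S \<subseteq> \<Union>E" using S(1) e(1) u by (auto simp: E'_def)
    moreover have "\<forall>f\<in>E. f \<inter> insert u S \<noteq> {}" using S(2) by (auto simp: E'_def)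
    moreover have "card (insert e M) = card (insert u S)"
      using \<open>e \<notin> M\<close> \<open>u \<notin> S\<close> \<open>finite M\<close> \<open>finite S\<close> M(2) by simp
    ultimately show ?thesis by blast
  qed
qed

section \<open>Matching numbers and the EG Property of forests\<close>

lemma finite_matchings: "finite E \<Longrightarrow> finite {M. matching_in E M}"
  by (rule finite_subset[of _ "Pow E"]) (auto simp: matching_in_def)

lemma card_le_matching_number:
  "finite E \<Longrightarrow> matching_in E M \<Longrightarrow> card M \<le> matching_number E"
  unfolding matching_number_def by (intro Max_ge finite_imageI finite_matchings) auto

lemma matching_number_mono:
  assumes "finite E" "H \<subseteq> E"
  shows "matching_number H \<le> matching_number E"
proof -
  have "finite H" using assms by (rule rev_finite_subset)
  show ?thesis
    unfolding matching_number_def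
  proof (rule Max_mono)
    show "card ` {M. matching_in H M} \<subseteq> card ` {M. matching_in E M}"
      using assms(2) by (auto simp: matching_in_def)
    show "card ` {M. matching_in H M} \<noteq> {}"
      by (auto simp: matching_in_def intro!: exI[of _ "{}"])
  qed (simp add: assms(1) finite_matchings)
qed

text \<open>Picking a cover vertex on each edge of a matching is injective, because the edges are
  pairwise disjoint.\<close>

lemma matching_number_le_cover:
  assumes "finite E" "finite S" "\<And>e. e \<in> E \<Longrightarrow> e \<inter> S \<noteq> {}"
  shows "matching_number E \<le> card S"
proof -
  have "card M \<le> card S" if M: "matching_in E M" for M
  proof -
    have "\<forall>e\<in>M. \<exists>v. v \<in> e \<inter> S" using M assms(3) by (auto simp: matching_in_def)
    then obtain g where g: "\<And>e. e \<in> M \<Longrightarrow> g e \<in> e \<inter> S" by metis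
    have "inj_on g M"
    proof (rule inj_onI)
      fix e f assume "e \<in> M" "f \<in> M" "g e = g f"
      then have "\<not> disjnt e f" using g by (metis IntD1 disjnt_iff)
      then show "e = f" using M \<open>e \<in> M\<close> \<open>f \<in> M\<close> by (auto simp: matching_in_def pairwise_def)
    qed
    then show ?thesis using g assms(2) by (intro card_inj_on_le[of g]) auto
  qed
  moreover have "matching_in E {}" by (simp add: matching_in_def)
  ultimately show ?thesis
    unfolding matching_number_def using assms(1) finite_matchings
    by (intro Max.boundedI) auto
qed

lemma forest_EG_property:
  assumes "finite V" "E \<subseteq> nsets V 2"
    and forest: "\<And>F. F \<subseteq> E \<Longrightarrow> F \<noteq> {} \<Longrightarrow> card F < card (\<Union>F)"
  shows "EG_property V E"
  unfolding EG_property_def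
proof (intro allI impI disjI2)
  fix k H assume H: "largest_subgraph_with_matching_number E k H"
  have "finite E" using assms(1,2) by (meson finite_imp_finite_nsets finite_subset)
  have "H \<subseteq> E" "matching_number H = k"
    and max: "\<And>H'. H' \<subseteq> E \<Longrightarrow> matching_number H' = k \<Longrightarrow> card H' \<le> card H"
    using H by (auto simp: largest_subgraph_with_matching_number_def)
  have "finite H" using \<open>finite E\<close> \<open>H \<subseteq> E\<close> by (rule rev_finite_subset)
  have card2: "\<And>e. e \<in> H \<Longrightarrow> card e = 2" using \<open>H \<subseteq> E\<close> assms(2) by (auto simp: nsets_def)
  obtain S M where S: "S \<subseteq> \<Union>H" "\<forall>e\<in>H. e \<inter> S \<noteq> {}" and M: "matching_in H M" "card M = card S"
    using forest_koenig[OF \<open>finite H\<close> card2] forest \<open>H \<subseteq> E\<close> by (meson subset_trans)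
  have "S \<subseteq> V" using S(1) \<open>H \<subseteq> E\<close> assms(2) by (auto simp: nsets_def)
  then have "finite S" using assms(1) by (rule finite_subset)
  \<comment> \<open>The matching \<open>M\<close> gives \<open>card S = card M \<le> k\<close>, and
    the cover \<open>S\<close> gives \<open>k \<le> card S\<close>.\<close>
  have "card S = k"
    using card_le_matching_number[OF \<open>finite H\<close> M(1)] M(2) \<open>matching_number H = k\<close>
      matching_number_le_cover[OF \<open>finite H\<close> \<open>finite S\<close>] S(2) by force
  define H' where "H' = {e \<in> E. e \<inter> S \<noteq> {}}"
  have "H \<subseteq> H'" using S(2) \<open>H \<subseteq> E\<close> by (auto simp: H'_def)
  have "finite H'" using \<open>finite E\<close> by (simp add: H'_def)
  \<comment> \<open>At least \<open>k\<close> because \<open>H'\<close> contains \<open>H\<close>,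
    at most \<open>k\<close> because \<open>S\<close> still covers \<open>H'\<close>.\<close>
  have "matching_number H' = k"
    using matching_number_mono[OF \<open>finite H'\<close> \<open>H \<subseteq> H'\<close>] \<open>matching_number H = k\<close> \<open>card S = k\<close>
      matching_number_le_cover[OF \<open>finite H'\<close> \<open>finite S\<close>] by (force simp: H'_def)
  then have "card H' \<le> card H" by (intro max) (auto simp: H'_def)
  then have "H = H'" using card_seteq[OF \<open>finite H'\<close> \<open>H \<subseteq> H'\<close>] by simp
  then show "\<exists>S. S \<subseteq> V \<and> card S = k \<and> H = {e \<in> E. e \<inter> S \<noteq> {}}"
    using \<open>S \<subseteq> V\<close> \<open>card S = k\<close> H'_def by blast
qed

section \<open>First-moment bound for the failure to be a forest\<close>

lemma prob_erdos_renyi_superset: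
  assumes "p \<in> {0..1}" "F \<subseteq> nsets {..<n} 2"
  shows "measure_pmf.prob (erdos_renyi n p) {E. F \<subseteq> E} = p ^ card F"
proof -
  define A where "A = nsets {..<n} 2"
  have "finite A" unfolding A_def by (simp add: finite_imp_finite_nsets)
  have "F \<subseteq> A" using assms(2) by (simp add: A_def)
  \<comment> \<open>\<open>B e\<close> is the set of values allowed for the indicator of
    \<open>e\<close>. The event thus becomes a product set, and independence gives a factor
    \<open>p\<close> for each edge of \<open>F\<close> and 1 for every other pair.\<close>
  define B where "B = (\<lambda>e. if e \<in> F then {True} else UNIV)"
  have "measure_pmf.prob (erdos_renyi n p) {E. F \<subseteq> E}
      = measure_pmf.prob (Pi_pmf A False (\<lambda>_. bernoulli_pmf p)) (Pi A B)"
    unfolding erdos_renyi_def measure_map_pmf A_def[symmetric]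
    using \<open>F \<subseteq> A\<close> by (intro arg_cong[where f = "measure_pmf.prob _"]) (auto simp: B_def Pi_def split: if_splits)
  also have "\<dots> = (\<Prod>e\<in>A. measure_pmf.prob (bernoulli_pmf p) (B e))"
    using \<open>finite A\<close> by (rule measure_Pi_pmf_Pi)
  also have "\<dots> = (\<Prod>e\<in>A. if e \<in> F then p else 1)"
    using assms(1) by (intro prod.cong) (auto simp: B_def measure_pmf_single)
  also have "\<dots> = (\<Prod>e\<in>F. p)"
    using \<open>finite A\<close> \<open>F \<subseteq> A\<close> by (simp add: prod.If_cases Int_absorb1)
  finally show ?thesis by simp
qed

text \<open>\<open>k^k / k!\<close> is a single term of the exponential series at \<open>k\<close>,
  whose terms are all nonnegative.\<close>

lemma power_le_exp_mult_fact: "real k ^ k \<le> exp (real k) * fact k"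
proof -
  have "(\<Sum>i\<in>{k}. inverse (fact i) * real k ^ i) \<le> (\<Sum>i. inverse (fact i) * real k ^ i)"
    by (rule sum_le_suminf) (use summable_exp[of "real k"] in auto)
  then have "real k ^ k / fact k \<le> exp (real k)"
    by (simp add: exp_def field_simps)
  then show ?thesis by (simp add: field_simps)
qed

text \<open>The left side counts the choices of \<open>k\<close> vertices and of \<open>k\<close>
  edges among them. With \<open>k choose 2\<close> bounded by \<open>k^2\<close> it is at most
  \<open>n^k * (k^k / k!)^2\<close>, and each factor \<open>k^k / k!\<close> is at most
  \<open>exp k\<close>.\<close>

lemma choose_mult_choose_le:
  "real (n choose k) * real ((k choose 2) choose k) \<le> (exp 2 * real n) ^ k"
proof -
  have *: "real (m choose k) \<le> real m ^ k / fact k" for m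
  proof -
    have "real ((m choose k) * fact k) \<le> real (m ^ k)"
      using binomial_fact_pow[of m k] by (simp only: of_nat_le_iff)
    then show ?thesis by (simp add: field_simps)
  qed
  have "(k choose 2) \<le> k\<^sup>2"
    unfolding choose_two power2_eq_square
    by (rule order_trans[OF div_le_dividend]) simp
  then have "real (k choose 2) \<le> (real k)\<^sup>2"
    by (metis of_nat_le_iff of_nat_power)
  then have "real (k choose 2) ^ k \<le> ((real k)\<^sup>2) ^ k"
    by (rule power_mono) simp
  then have k2: "real (k choose 2) ^ k \<le> (real k ^ k)\<^sup>2"
    by (simp only: flip: power_mult) (simp only: mult.commute)
  have "real (n choose k) * real ((k choose 2) choose k)
      \<le> (real n ^ k / fact k) * (real (k choose 2) ^ k / fact k)"
    by (intro mult_mono *) auto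
  also have "\<dots> \<le> (real n ^ k / fact k) * ((real k ^ k)\<^sup>2 / fact k)"
    by (intro mult_left_mono divide_right_mono k2) auto
  also have "\<dots> = real n ^ k * (real k ^ k / fact k)\<^sup>2"
    by (simp add: power2_eq_square)
  also have "\<dots> \<le> real n ^ k * (exp (real k))\<^sup>2"
    using power_le_exp_mult_fact[of k]
    by (intro mult_left_mono power_mono) (auto simp: divide_le_eq)
  also have "\<dots> = (exp 2 * real n) ^ k"
    by (simp add: power_mult_distrib flip: exp_of_nat_mult)
  finally show ?thesis .
qed

text \<open>Union bound over the configurations in \<open>I k\<close>, each present with probability
  \<open>p^k\<close>. The event itself demands \<open>F \<subseteq> nsets {..<n} 2\<close>, so that
  its inclusion in the finite union also holds for \<open>E\<close> outside the support.\<close>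

lemma prob_not_forest_le:
  assumes "p \<in> {0..1}"
  shows "measure_pmf.prob (erdos_renyi n p) {E. \<exists>F\<subseteq>E. F \<noteq> {} \<and> F \<subseteq> nsets {..<n} 2 \<and> card (\<Union>F) \<le> card F}
    \<le> (\<Sum>k=1..n. (exp 2 * real n * p) ^ k)"
    (is "measure_pmf.prob ?G ?C \<le> _")
proof -
  define I where "I k = Sigma (nsets {..<n} k) (\<lambda>U. nsets (nsets U 2) k)" for k
  have finI: "finite (I k)" for k
    unfolding I_def
    by (intro finite_SigmaI finite_imp_finite_nsets) (auto simp: nsets_def)
  have cardI: "card (I k) = (n choose k) * ((k choose 2) choose k)" for k
  proof -
    have "card (I k) = (\<Sum>U\<in>nsets {..<n} k. card (nsets (nsets U 2) k))"
      unfolding I_def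
      by (intro card_SigmaI) (auto simp: nsets_def intro!: finite_imp_finite_nsets)
    also have "\<dots> = (\<Sum>U\<in>nsets {..<n} k. (k choose 2) choose k)"
    proof (rule sum.cong)
      fix U assume "U \<in> nsets {..<n} k"
      then have "card U = k" by (simp add: nsets_def)
      then show "card (nsets (nsets U 2) k) = (k choose 2) choose k" by simp
    qed simp
    finally show ?thesis by simp
  qed
  have "?C \<subseteq> (\<Union>k\<in>{1..n}. \<Union>i\<in>I k. {E. snd i \<subseteq> E})"
  proof
    fix E assume "E \<in> ?C"
    then obtain F where F: "F \<subseteq> E" "F \<noteq> {}" "F \<subseteq> nsets {..<n} 2" "card (\<Union>F) \<le> card F"
      by blast
    define U where "U = \<Union>F"
    have "U \<subseteq> {..<n}" using F(3) by (auto simp: U_def nsets_def)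
    then have "finite U" by (rule finite_subset) simp
    have "U \<noteq> {}" using F(2,3) by (fastforce simp: U_def nsets_def)
    \<comment> \<open>Surplus edges are discarded until there are exactly as many as vertices in
      \<open>U\<close>. \<open>F'\<close> may cover less than \<open>U\<close>; it only has to live
      inside \<open>U\<close>.\<close>
    obtain F' where F': "F' \<subseteq> F" "card F' = card U" "finite F'"
      using F(4) obtain_subset_with_card_n U_def by metis
    \<comment> \<open>Excluding size 0 matters: its term in the bound would be 1.\<close>
    have "card U \<in> {1..n}"
      using \<open>U \<noteq> {}\<close> \<open>finite U\<close> card_mono[OF _ \<open>U \<subseteq> {..<n}\<close>]
      by (auto simp: Suc_le_eq card_gt_0_iff)
    moreover have "F' \<subseteq> nsets U 2" using F' F(3) by (auto simp: U_def nsets_def)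
    then have "(U, F') \<in> I (card U)"
      using F' \<open>finite U\<close> \<open>U \<subseteq> {..<n}\<close> by (auto simp: I_def nsets_def)
    moreover have "snd (U, F') \<subseteq> E" using F' F(1) by auto
    ultimately show "E \<in> (\<Union>k\<in>{1..n}. \<Union>i\<in>I k. {E. snd i \<subseteq> E})" by blast
  qed
  then have "measure_pmf.prob ?G ?C \<le> measure_pmf.prob ?G (\<Union>k\<in>{1..n}. \<Union>i\<in>I k. {E. snd i \<subseteq> E})"
    by (intro measure_pmf.finite_measure_mono) auto
  also have "\<dots> \<le> (\<Sum>k=1..n. measure_pmf.prob ?G (\<Union>i\<in>I k. {E. snd i \<subseteq> E}))"
    by (intro measure_pmf.finite_measure_subadditive_finite) auto
  also have "\<dots> \<le> (\<Sum>k=1..n. \<Sum>i\<in>I k. measure_pmf.prob ?G {E. snd i \<subseteq> E})"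
    by (intro sum_mono measure_pmf.finite_measure_subadditive_finite finI) auto
  also have "\<dots> = (\<Sum>k=1..n. \<Sum>i\<in>I k. p ^ k)"
  proof (intro sum.cong refl)
    fix k i assume "i \<in> I k"
    then have "snd i \<subseteq> nsets {..<n} 2" "card (snd i) = k"
      by (fastforce simp: I_def nsets_def)+
    then show "measure_pmf.prob ?G {E. snd i \<subseteq> E} = p ^ k"
      using prob_erdos_renyi_superset[OF assms] by simp
  qed
  also have "\<dots> = (\<Sum>k=1..n. real (n choose k) * real ((k choose 2) choose k) * p ^ k)"
    by (simp add: cardI)
  also have "\<dots> \<le> (\<Sum>k=1..n. (exp 2 * real n) ^ k * p ^ k)"
    using assms by (intro sum_mono mult_right_mono choose_mult_choose_le) auto
  finally show ?thesis by (simp add: power_mult_distrib)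
qed

lemma sum_power_le_double:
  fixes x :: real
  assumes "0 \<le> x" "x \<le> 1 / 2"
  shows "(\<Sum>k=1..n. x ^ k) \<le> 2 * x"
proof -
  \<comment> \<open>The subtracted term makes the induction work: it is an equality at 0, and the
    step amounts to \<open>2 * x \<le> 1\<close>.\<close>
  have "(\<Sum>k=1..n. x ^ k) \<le> 2 * x - 2 * x ^ Suc n"
  proof (induction n)
    case (Suc n)
    have "2 * x * x ^ Suc n \<le> 1 * x ^ Suc n"
      using assms by (intro mult_right_mono) auto
    with Suc show ?case by (simp add: algebra_simps)
  qed (use assms in simp)
  then show ?thesis using assms(1) zero_le_power[of x "Suc n"] by linarith
qed

section \<open>Passage to the random graph and the limit\<close>

lemma prob_EG_property_ge:
  assumes "p \<in> {0..1}" "exp 2 * (real n * p) \<le> 1 / 2"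
  shows "1 - 2 * (exp 2 * (real n * p)) \<le> measure_pmf.prob (erdos_renyi n p) {E. EG_property {..<n} E}"
proof -
  let ?G = "erdos_renyi n p"
  let ?C = "{E. \<exists>F\<subseteq>E. F \<noteq> {} \<and> F \<subseteq> nsets {..<n} 2 \<and> card (\<Union>F) \<le> card F}"
  have "measure_pmf.prob ?G ?C \<le> (\<Sum>k=1..n. (exp 2 * (real n * p)) ^ k)"
    using prob_not_forest_le[OF assms(1)] by (simp add: mult.assoc)
  also have "\<dots> \<le> 2 * (exp 2 * (real n * p))"
    using assms by (intro sum_power_le_double) auto
  finally have "1 - 2 * (exp 2 * (real n * p)) \<le> measure_pmf.prob ?G (- ?C)"
    using measure_pmf.prob_compl[of ?C ?G] by (simp add: Compl_eq_Diff_UNIV)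
  \<comment> \<open>The inclusion of events is shown only almost surely: outcomes in the support are
    sets of two-element subsets of \<open>{..<n}\<close>, as \<open>forest_EG_property\<close>
    requires.\<close>
  also have "\<dots> \<le> measure_pmf.prob ?G {E. EG_property {..<n} E}"
  proof (rule measure_pmf.finite_measure_mono_AE)
    have "EG_property {..<n} E" if "E \<in> set_pmf ?G" "E \<in> - ?C" for E
    proof (rule forest_EG_property)
      show E: "E \<subseteq> nsets {..<n} 2" using that(1) by (auto simp: erdos_renyi_def)
      show "card F < card (\<Union>F)" if "F \<subseteq> E" "F \<noteq> {}" for F
      proof -
        have "F \<subseteq> nsets {..<n} 2" using that(1) E by (rule subset_trans)
        then have "\<not> card (\<Union>F) \<le> card F" using that \<open>E \<in> - ?C\<close> by blast
        then show ?thesis by simp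
      qed
    qed simp
    then show "AE E in measure_pmf ?G. E \<in> - ?C \<longrightarrow> E \<in> {E. EG_property {..<n} E}"
      by (auto simp: AE_measure_pmf_iff)
  qed simp
  finally show ?thesis .
qed

theorem corollary4p3:
  fixes p :: "nat \<Rightarrow> real"
  assumes "\<And>n. p n \<in> {0..1}"
    and "(\<lambda>n. real n * p n) \<longlonglongrightarrow> 0"
  shows "with_high_probability (\<lambda>n. erdos_renyi n (p n)) (\<lambda>n. EG_property {..<n})"
  unfolding with_high_probability_def
proof (rule tendsto_sandwich)
  have lim: "(\<lambda>n. exp 2 * (real n * p n)) \<longlonglongrightarrow> 0"
    using tendsto_mult_right_zero[OF assms(2)] .
  \<comment> \<open>The geometric sum is controlled only for ratio at most 1/2, so the lower bound
    is available just for large \<open>n\<close>.\<close>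
  have "\<forall>\<^sub>F n in sequentially. exp 2 * (real n * p n) < 1 / 2"
    by (rule order_tendstoD(2)[OF lim]) simp
  then show "\<forall>\<^sub>F n in sequentially. 1 - 2 * (exp 2 * (real n * p n))
      \<le> measure_pmf.prob (erdos_renyi n (p n)) {E. EG_property {..<n} E}"
    by eventually_elim (use prob_EG_property_ge[OF assms(1)] in simp)
  show "(\<lambda>n. 1 - 2 * (exp 2 * (real n * p n))) \<longlonglongrightarrow> 1"
    using tendsto_diff[OF tendsto_const[of 1] tendsto_mult_right_zero[OF lim, of 2]] by simp
  show "(\<lambda>_. 1 :: real) \<longlonglongrightarrow> 1" by (rule tendsto_const)
qed simp

end
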